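(* Let $k\ge 6$ be an integer. Let $T$ be a square of side length $h>0$ with sides parallel to the coordinate axes and vertices $\mathbf{x}_1$ (lower left), $\mathbf{x}_2=\mathbf{x}_1+h\langle 1,0\rangle$, $\mathbf{x}_3=\mathbf{x}_1+h\langle 1,1\rangle$, $\mathbf{x}_4=\mathbf{x}_1+h\langle 0,1\rangle$. Let $$V_k(T)=\mathrm{span}\{P_k(T),\ b_1^{1,0},\ b_1^{2,0},\ b_3^{1,0},\ b_3^{2,0},\ b_1^{k-2,0},\ b_2^{1,0},\ b_3^{k-3,0},\ b_4^{1,0}\},$$ where the $b_\ell^{i,j}$ are the nodal basis functions of the $C^1$-$Q_k$ Bell element defined in the context. Then the following degrees of freedom uniquely determine the functions $p\in V_k(T)$ (that is, for every prescription of real values for these functionals there is exactly one $p\in V_k(T)$ attaining them): $$p(\mathbf{x}_i),\ \partial_x p(\mathbf{x}_i),\ \partial_y p(\mathbf{x}_i),\ \partial_{xy}p(\mathbf{x}_i),\quad i=1,2,3,4;$$ $$p\Big(\frac{j\mathbf{x}_1+(k-2-j)\mathbf{x}_2}{k-2}\Big),\ p\Big(\frac{j\mathbf{x}_2+(k-2-j)\mathbf{x}_3}{k-2}\Big),\ p\Big(\frac{j\mathbf{x}_4+(k-2-j)\mathbf{x}_3}{k-2}\Big),\ p\Big(\frac{j\mathbf{x}_1+(k-2-j)\mathbf{x}_4}{k-2}\Big),\quad j=1,\dots,k-3;$$ $$\partial_y p\Big(\frac{j\mathbf{x}_4+(k-3-j)\mathbf{x}_3}{k-3}\Big),\ \partial_y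 p\Big(\frac{j\mathbf{x}_1+(k-3-j)\mathbf{x}_2}{k-3}\Big),\quad j=1,\dots,k-4;$$ $$\partial_x p\Big(\frac{j\mathbf{x}_2+(k-3-j)\mathbf{x}_3}{k-3}\Big),\ \partial_x p\Big(\frac{j\mathbf{x}_1+(k-3-j)\mathbf{x}_4}{k-3}\Big),\quad j=1,\dots,k-4;$$ and, when $k>7$, $$p\Big(\frac{i\mathbf{x}_2+j\mathbf{x}_4+(k-2-i-j)\mathbf{x}_1}{k-2}\Big),\quad i=1,\dots,k-7,\ j=1,\dots,i.$$
   Context: $P_k(T)$ denotes the polynomials in $(x,y)$ of total degree at most $k$ restricted to $T$, and $Q_k=\mathrm{span}\{x^{k_1}y^{k_2}: 0\le k_1,k_2\le k\}$. On an edge $e$, $Q_{k-1}(e)$ is the space of univariate polynomials of degree at most $k-1$ on $e$, and $\partial_{\mathbf n}$ is the normal derivative on $e$. The $C^1$-$Q_k$ Bell element space on $T$ is $W_k(T)=\{v\in Q_k(T): \partial_{\mathbf n}v|_e\in Q_{k-1}(e) \text{ for each edge } e \text{ of } T\}$. Its (known unisolvent) degrees of freedom are: (1) $v$ at $\mathbf{x}_1+\frac h{k-2}\langle i,j\rangle$, $i,j=0,\dots,k-2$; (2) $\partial_x v$ at $\mathbf{x}_1+h\langle i,\frac j{k-3}\rangle$, $i=0,1$, $j=0,\dots,k-3$; (3) $\partial_y v$ at $\mathbf{x}_1+h\langle \frac i{k-3},j\rangle$, $i=0,\dots,k-3$, $j=0,1$; (4) $\partial_{xy}v$ at $\mathbf{x}_1+h\langle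 i,j\rangle$, $i,j=0,1$. The nodal basis of $W_k(T)$ dual to these degrees of freedom is denoted $b_1^{i,j}$, $b_2^{i,j}$, $b_3^{i,j}$, $b_4^{i,j}$, where $b_\ell^{i,j}\in W_k(T)$ takes value $1$ on the degree of freedom of type $(\ell)$ with index $(i,j)$ and $0$ on all other degrees of freedom in the list. *)

theory Defs
  imports "HOL-Analysis.Analysis" "HOL-Library.Function_Algebras"
    "HOL-Computational_Algebra.Polynomial"
begin

instantiation "fun" :: (type, real_vector) real_vector
begin

definition scaleR_fun :: "real \<Rightarrow> ('a \<Rightarrow> 'b) \<Rightarrow> 'a \<Rightarrow> 'b"
  where "scaleR_fun c f = (\<lambda>z. c *\<^sub>R f z)"

instance
  by standard (auto simp: scaleR_fun_def plus_fun_def scaleR_add_right scaleR_add_left)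

end

text \<open>
  A polynomial on the square \<open>T\<close> is identified with the polynomial function on the whole plane that
  it extends to; the extension is unique because \<open>T\<close> has interior points. Derivatives at
  boundary points of \<open>T\<close> are those of the extension.
\<close>

definition monomial2 :: "nat \<Rightarrow> nat \<Rightarrow> real \<times> real \<Rightarrow> real" where
  "monomial2 a b = (\<lambda>(x, y). x ^ a * y ^ b)"

definition P_space :: "nat \<Rightarrow> (real \<times> real \<Rightarrow> real) set" where
  "P_space k = span {monomial2 a b | a b. a + b \<le> k}"

definition Q_space :: "nat \<Rightarrow> (real \<times> real \<Rightarrow> real) set" where
  "Q_space k = span {monomial2 a b | a b. a \<le> k \<and> b \<le> k}"

definition dir_deriv :: "real \<times> real \<Rightarrow> (real \<times> real \<Rightarrow> real) \<Rightarrow> real \<times> real \<Rightarrow> real" where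
  "dir_deriv n v z = deriv (\<lambda>s. v (z + s *\<^sub>R n)) 0"

definition pdx :: "(real \<times> real \<Rightarrow> real) \<Rightarrow> real \<times> real \<Rightarrow> real" where
  "pdx = dir_deriv (1, 0)"

definition pdy :: "(real \<times> real \<Rightarrow> real) \<Rightarrow> real \<times> real \<Rightarrow> real" where
  "pdy = dir_deriv (0, 1)"

definition pdxy :: "(real \<times> real \<Rightarrow> real) \<Rightarrow> real \<times> real \<Rightarrow> real" where
  "pdxy v = pdy (pdx v)"

text \<open>The edges of the square with lower left vertex \<open>x1\<close> and side length \<open>h\<close>, each given by its
  two end points and its outward unit normal.\<close>

definition square_edges ::
  "real \<times> real \<Rightarrow> real \<Rightarrow> ((real \<times> real) \<times> (real \<times> real) \<times> (real \<times> real)) set" where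
  "square_edges x1 h =
    {(x1, x1 + h *\<^sub>R (1, 0), (0, -1)),
     (x1 + h *\<^sub>R (1, 0), x1 + h *\<^sub>R (1, 1), (1, 0)),
     (x1 + h *\<^sub>R (1, 1), x1 + h *\<^sub>R (0, 1), (0, 1)),
     (x1 + h *\<^sub>R (0, 1), x1, (-1, 0))}"

definition edge_poly :: "nat \<Rightarrow> real \<times> real \<Rightarrow> real \<times> real \<Rightarrow> (real \<times> real \<Rightarrow> real) \<Rightarrow> bool" where
  "edge_poly m a b g \<longleftrightarrow>
    (\<exists>q :: real poly. degree q \<le> m \<and> (\<forall>t\<in>{0..1}. g ((1 - t) *\<^sub>R a + t *\<^sub>R b) = poly q t))"

definition bell_space :: "nat \<Rightarrow> real \<times> real \<Rightarrow> real \<Rightarrow> (real \<times> real \<Rightarrow> real) set" where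
  "bell_space k x1 h =
    {v \<in> Q_space k. \<forall>(a, b, n) \<in> square_edges x1 h. edge_poly (k - 1) a b (dir_deriv n v)}"

text \<open>The index \<open>(l, i, j)\<close> stands for the degree of freedom of type \<open>l\<close> with index \<open>(i, j)\<close>.\<close>

definition bell_index :: "nat \<Rightarrow> (nat \<times> nat \<times> nat) set" where
  "bell_index k =
    {(1, i, j) | i j. i \<le> k - 2 \<and> j \<le> k - 2} \<union>
    {(2, i, j) | i j. i \<le> 1 \<and> j \<le> k - 3} \<union>
    {(3, i, j) | i j. i \<le> k - 3 \<and> j \<le> 1} \<union>
    {(4, i, j) | i j. i \<le> 1 \<and> j \<le> 1}"

definition bell_dof ::
  "nat \<Rightarrow> real \<times> real \<Rightarrow> real \<Rightarrow> nat \<Rightarrow> nat \<Rightarrow> nat \<Rightarrow> (real \<times> real \<Rightarrow> real) \<Rightarrow> real" where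
  "bell_dof k x1 h l i j v =
    (if l = 1 then v (x1 + (h / (real k - 2)) *\<^sub>R (real i, real j))
     else if l = 2 then pdx v (x1 + h *\<^sub>R (real i, real j / (real k - 3)))
     else if l = 3 then pdy v (x1 + h *\<^sub>R (real i / (real k - 3), real j))
     else pdxy v (x1 + h *\<^sub>R (real i, real j)))"

text \<open>The degrees of freedom being unisolvent on \<open>bell_space k x1 h\<close>, a nodal basis exists and is
  uniquely determined at the indices in \<open>bell_index k\<close>.\<close>

definition bell_nodal_basis ::
  "nat \<Rightarrow> real \<times> real \<Rightarrow> real \<Rightarrow> (nat \<Rightarrow> nat \<Rightarrow> nat \<Rightarrow> real \<times> real \<Rightarrow> real) \<Rightarrow> bool" where
  "bell_nodal_basis k x1 h b \<longleftrightarrow>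
    (\<forall>(l, i, j) \<in> bell_index k.
      b l i j \<in> bell_space k x1 h \<and>
      (\<forall>(l', i', j') \<in> bell_index k.
        bell_dof k x1 h l' i' j' (b l i j) = (if (l', i', j') = (l, i, j) then 1 else 0)))"

definition V_space ::
  "nat \<Rightarrow> (nat \<Rightarrow> nat \<Rightarrow> nat \<Rightarrow> real \<times> real \<Rightarrow> real) \<Rightarrow> (real \<times> real \<Rightarrow> real) set" where
  "V_space k b =
    span (P_space k \<union>
      {b 1 1 0, b 1 2 0, b 3 1 0, b 3 2 0, b 1 (k - 2) 0, b 2 1 0, b 3 (k - 3) 0, b 4 1 0})"

definition seg_point :: "nat \<Rightarrow> nat \<Rightarrow> real \<times> real \<Rightarrow> real \<times> real \<Rightarrow> real \<times> real" where
  "seg_point m j a b = (real j *\<^sub>R a + (real m - real j) *\<^sub>R b) /\<^sub>R real m"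

end

theory Submission
  imports Defs
begin

text \<open>All the functionals in the statement are degrees of freedom of the Bell element, and the eight Bell
  functions in \<open>V_k\<close> are dual to eight of them. These eight functions therefore cannot be seen by the
  remaining functionals, and the claim reduces to one about polynomials alone: \<open>P_k\<close> is unisolvent for
  the remaining functionals (\<open>unisolvent_extend_by_dual_vectors\<close>).

  The remaining functionals number at most \<open>dim P_k\<close>, so only injectivity has to be shown
  (\<open>unisolvent_by_counting\<close>). Let \<open>q\<close> in \<open>P_k\<close> have vanishing data. On the left edge all the data are
  still there, \<open>k + 1\<close> conditions on \<open>q\<close> and \<open>k\<close> conditions on its normal derivative, and hence \<open>q\<close>
  is divisible by the square of the equation of that edge. The quotient has total degree \<open>k - 2\<close>, so on
  the next edge two conditions fewer are needed, and on the following ones fewer still. They are read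
  off at nodes away from the edges divided out before, where the quotient inherits the zeros of \<open>q\<close>.
  Going around as left, top, right, bottom, the conditions that become dispensable on the right and
  bottom edge are exactly those belonging to the eight Bell functions
  (\<open>P_space_determined\<close>). What is left after four edges has degree at most \<open>k - 8\<close> and vanishes on
  a triangular lattice of matching size, hence is zero (\<open>triangular_lattice_unisolvent\<close>).\<close>

section \<open>Unisolvence in real vector spaces\<close>

lemma sum_apply_at: "(\<Sum>i\<in>A. g i) z = (\<Sum>i\<in>A. g i z)"
  for g :: "'i \<Rightarrow> 'z \<Rightarrow> real"
  by (induction A rule: infinite_finite_induct) auto

text \<open>Injectivity on the span of at least as many independent vectors as there are functionals already
  forces existence: the images of the basis are independent and live in the space of functions
  supported on \<open>E\<close>, which is spanned by only \<open>card E\<close> functions, so they must span it. Only an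
  upper bound on the number of functionals has to be supplied. The functionals are assumed linear on
  \<open>span B\<close> alone, because derivatives of arbitrary functions are not additive.\<close>
lemma unisolvent_by_counting:
  fixes B :: "'v::real_vector set" and \<phi> :: "'d \<Rightarrow> 'v \<Rightarrow> real" and w :: "'d \<Rightarrow> real"
  assumes B: "independent B" and finE: "finite E" and card: "card E \<le> card B"
    and add: "\<And>d u v. d \<in> E \<Longrightarrow> u \<in> span B \<Longrightarrow> v \<in> span B \<Longrightarrow> \<phi> d (u + v) = \<phi> d u + \<phi> d v"
    and scale: "\<And>d a u. d \<in> E \<Longrightarrow> u \<in> span B \<Longrightarrow> \<phi> d (a *\<^sub>R u) = a * \<phi> d u"
    and inj: "\<And>u. u \<in> span B \<Longrightarrow> \<forall>d\<in>E. \<phi> d u = 0 \<Longrightarrow> u = 0"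
  shows "\<exists>u\<in>span B. \<forall>d\<in>E. \<phi> d u = w d"
proof -
  define L where "L u = (\<lambda>d. if d \<in> E then \<phi> d u else 0)" for u
  define unit_fun :: "'d \<Rightarrow> 'd \<Rightarrow> real" where "unit_fun d = (\<lambda>e. if e = d then 1 else 0)" for d
  have supported: "g \<in> span (unit_fun ` E)" if "\<And>d. d \<notin> E \<Longrightarrow> g d = 0" for g
  proof -
    have "g = (\<Sum>d\<in>E. g d *\<^sub>R unit_fun d)"
    proof
      show "g e = (\<Sum>d\<in>E. g d *\<^sub>R unit_fun d) e" for e
        using that[of e] finE
        by (simp add: sum_apply_at unit_fun_def scaleR_fun_def if_distrib cong: if_cong)
    qed
    also have "\<dots> \<in> span (unit_fun ` E)"
      by (intro span_sum span_scale span_base) auto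
    finally show ?thesis .
  qed
  \<comment> \<open>\<open>L\<close> is linear on \<open>span B\<close> only, so it is replaced by a globally linear map that agrees with it
    there and to which the library facts about linear maps apply.\<close>
  obtain g where lin: "linear g" and gB: "\<forall>x\<in>B. g x = L x"
    using linear_independent_extend[OF B, of L] by blast
  have g: "g u = L u" if "u \<in> span B" for u
  proof -
    have "u \<in> span B \<and> g u = L u"
      using that
    proof (induction rule: real_vector.span_induct_alt)
      case base
      have "L 0 = 0"
        using scale[of _ 0 0] by (auto simp: L_def span_zero fun_eq_iff)
      then show ?case
        by (simp add: lin linear_0 span_zero)
    next
      case (step c x y)
      then have x: "x \<in> span B"
        by (simp add: span_base)
      with step have "L (c *\<^sub>R x + y) = c *\<^sub>R L x + L y"
        by (auto simp: L_def fun_eq_iff scaleR_fun_def add scale span_scale)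
      with step x gB show ?case
        by (simp add: lin linear_add linear_scale span_add span_scale)
    qed
    then show ?thesis by simp
  qed
  have inj_g: "inj_on g (span B)"
  proof (rule inj_onI)
    fix u v assume u: "u \<in> span B" and v: "v \<in> span B" and "g u = g v"
    then have "g (u - v) = 0"
      by (simp add: lin linear_diff)
    moreover have uv: "u - v \<in> span B"
      by (simp add: u v span_diff)
    ultimately have L0: "L (u - v) = 0"
      by (simp add: g)
    have "\<phi> d (u - v) = 0" if "d \<in> E" for d
      using fun_cong[OF L0, of d] that by (simp add: L_def)
    with inj[OF uv] show "u = v" by simp
  qed
  have card_gB: "card (g ` B) = card B"
    by (meson card_image inj_g inj_on_subset span_superset)
  have indep: "independent (g ` B)"
    using lin B inj_g by (rule linear_independent_injective_image)
  have card_units: "card (unit_fun ` E) \<le> card E"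
    by (simp add: card_image_le finE)
  have gB_units: "g ` B \<subseteq> span (unit_fun ` E)"
    by (auto intro!: supported simp: gB L_def)
  define W where "W = (\<lambda>d. if d \<in> E then w d else 0)"
  have W_units: "W \<in> span (unit_fun ` E)"
    by (rule supported) (simp add: W_def)
  have "W \<in> span (g ` B)"
  proof (rule ccontr)
    assume W: "W \<notin> span (g ` B)"
    then have "independent (insert W (g ` B))"
      using indep by (rule independent_insertI)
    then have *: "finite (insert W (g ` B))" "card (insert W (g ` B)) \<le> card (unit_fun ` E)"
      using independent_span_bound[of "unit_fun ` E" "insert W (g ` B)"] finE W_units gB_units
      by auto
    have "W \<notin> g ` B"
      using W span_base[of W "g ` B"] by argo
    then have "card (insert W (g ` B)) = Suc (card B)"
      using *(1) card_gB by simp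
    then show False
      using *(2) card card_units by linarith
  qed
  then obtain u where u: "u \<in> span B" "W = g u"
    by (auto simp: linear_span_image[OF lin])
  have "\<phi> d u = w d" if "d \<in> E" for d
    using fun_cong[OF u(2), of d] that by (simp add: g u(1) L_def W_def)
  with u(1) show ?thesis by blast
qed

text \<open>If \<open>P\<close> is unisolvent for the functionals \<open>E\<close>, then adjoining vectors that are dual to further
  functionals \<open>S\<close> and invisible to \<open>E\<close> keeps the space unisolvent: the values on \<open>E\<close> fix the
  component in \<open>P\<close>, and the values on \<open>S\<close> are then corrected one by one. The two parts never
  interact.\<close>
lemma unisolvent_extend_by_dual_vectors:
  fixes P M :: "'v::real_vector set" and \<phi> :: "'d \<Rightarrow> 'v \<Rightarrow> real" and b :: "'d \<Rightarrow> 'v"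
    and w :: "'d \<Rightarrow> real"
  assumes P: "subspace P" and M: "subspace M" and PM: "P \<subseteq> M" and bM: "b ` S \<subseteq> M"
    and finS: "finite S" and disj: "E \<inter> S = {}"
    and add: "\<And>d u v. d \<in> E \<union> S \<Longrightarrow> u \<in> M \<Longrightarrow> v \<in> M \<Longrightarrow> \<phi> d (u + v) = \<phi> d u + \<phi> d v"
    and scale: "\<And>d a u. d \<in> E \<union> S \<Longrightarrow> u \<in> M \<Longrightarrow> \<phi> d (a *\<^sub>R u) = a * \<phi> d u"
    and dual: "\<And>d s. d \<in> E \<union> S \<Longrightarrow> s \<in> S \<Longrightarrow> \<phi> d (b s) = (if d = s then 1 else 0)"
    and ex: "\<And>w. \<exists>q\<in>P. \<forall>d\<in>E. \<phi> d q = w d"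
    and inj: "\<And>q. q \<in> P \<Longrightarrow> \<forall>d\<in>E. \<phi> d q = 0 \<Longrightarrow> q = 0"
  shows "\<exists>!p. p \<in> span (P \<union> b ` S) \<and> (\<forall>d\<in>E \<union> S. \<phi> d p = w d)"
proof -
  have zero: "\<phi> d 0 = 0" if "d \<in> E \<union> S" for d
    using scale[OF that, of 0 0] M by (simp add: subspace_0)
  have comb: "(\<Sum>s\<in>A. a s *\<^sub>R b s) \<in> M \<and>
      \<phi> d (\<Sum>s\<in>A. a s *\<^sub>R b s) = (\<Sum>s\<in>A. if d = s then a s else 0)"
    if "A \<subseteq> S" "d \<in> E \<union> S" for A a d
  proof -
    have "finite A"
      using that(1) finS by (rule finite_subset)
    then show ?thesis
      using that(1)
    proof (induction A rule: finite_induct)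
      case empty
      then show ?case by (simp add: subspace_0 M zero[OF \<open>d \<in> E \<union> S\<close>])
    next
      case (insert s A)
      then have "b s \<in> M" using bM by auto
      then have "a s *\<^sub>R b s \<in> M" by (rule subspace_scale[OF M])
      with insert \<open>b s \<in> M\<close> show ?case
        using \<open>d \<in> E \<union> S\<close> by (simp add: subspace_add[OF M] add scale dual)
    qed
  qed
  have "\<exists>p. p \<in> span (P \<union> b ` S) \<and> (\<forall>d\<in>E \<union> S. \<phi> d p = w d)"
  proof -
    obtain q where q: "q \<in> P" "\<forall>d\<in>E. \<phi> d q = w d"
      using ex by blast
    define r where "r = (\<Sum>s\<in>S. (w s - \<phi> s q) *\<^sub>R b s)"
    have "\<phi> d (q + r) = w d" if d: "d \<in> E \<union> S" for d
    proof -
      have "r \<in> M" "\<phi> d r = (if d \<in> S then w d - \<phi> d q else 0)"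
        using comb[OF order_refl d] finS by (simp_all add: r_def)
      moreover have "q \<in> M"
        using q(1) PM by blast
      ultimately have "\<phi> d (q + r) = \<phi> d q + (if d \<in> S then w d - \<phi> d q else 0)"
        by (simp only: add[OF d])
      also have "\<dots> = w d"
        using d q(2) by auto
      finally show ?thesis .
    qed
    moreover have "q + r \<in> span (P \<union> b ` S)"
      unfolding r_def by (intro span_add span_sum span_scale span_base) (auto simp: q)
    ultimately show ?thesis by blast
  qed
  moreover have "p = p'" if p: "p \<in> span (P \<union> b ` S) \<and> (\<forall>d\<in>E \<union> S. \<phi> d p = w d)"
    and p': "p' \<in> span (P \<union> b ` S) \<and> (\<forall>d\<in>E \<union> S. \<phi> d p' = w d)" for p p'
  proof -
    have span_M: "span (P \<union> b ` S) \<subseteq> M"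
      by (rule span_minimal) (use PM bM M in auto)
    have span_b: "y \<in> span (b ` S) \<Longrightarrow> y \<in> M \<and> (\<forall>d\<in>E. \<phi> d y = 0) \<and> (\<Sum>s\<in>S. \<phi> s y *\<^sub>R b s) = y" for y
    proof (induction rule: real_vector.span_induct_alt)
      case base
      then show ?case by (simp add: subspace_0 M zero)
    next
      case (step c x y)
      then obtain t where t: "t \<in> S" "x = b t" by blast
      then have x: "x \<in> M" "c *\<^sub>R x \<in> M" using bM by (auto intro: subspace_scale[OF M])
      have \<phi>: "\<phi> d (c *\<^sub>R x + y) = c * (if d = t then 1 else 0) + \<phi> d y" if "d \<in> E \<union> S" for d
        using that x step t(1) by (simp add: add scale t(2) dual)
      have "(\<Sum>s\<in>S. \<phi> s (c *\<^sub>R x + y) *\<^sub>R b s)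
          = (\<Sum>s\<in>S. (if s = t then c *\<^sub>R b s else 0) + \<phi> s y *\<^sub>R b s)"
        by (rule sum.cong) (simp_all add: \<phi> scaleR_add_left)
      also have "\<dots> = c *\<^sub>R x + y"
        using step(2) t finS by (simp add: sum.distrib)
      finally have "(\<Sum>s\<in>S. \<phi> s (c *\<^sub>R x + y) *\<^sub>R b s) = c *\<^sub>R x + y" .
      moreover have "\<forall>d\<in>E. \<phi> d (c *\<^sub>R x + y) = 0"
        using step \<phi> t(1) disj by auto
      ultimately show ?case
        using x step by (simp add: subspace_add[OF M])
    qed
    have "p - p' \<in> span (P \<union> b ` S)"
      using p p' by (simp add: span_diff)
    then obtain q y where qy: "p - p' = q + y" "q \<in> P" "y \<in> span (b ` S)"
      by (auto simp: span_Un span_eq_iff[THEN iffD2, OF P])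
    have p_M: "p \<in> M" "p' \<in> M"
      using p p' span_M by auto
    have diff0: "\<phi> d (p - p') = 0" if "d \<in> E \<union> S" for d
    proof -
      have "\<phi> d p = \<phi> d (p - p') + \<phi> d p'"
        using add[OF that, of "p - p'" p'] p_M by (simp add: subspace_diff[OF M])
      then show ?thesis using p p' that by simp
    qed
    have y: "y \<in> M" "\<And>d. d \<in> E \<Longrightarrow> \<phi> d y = 0" "(\<Sum>s\<in>S. \<phi> s y *\<^sub>R b s) = y"
      using span_b[OF qy(3)] by blast+
    have sum0: "\<phi> d q + \<phi> d y = 0" if "d \<in> E \<union> S" for d
      using diff0[OF that] add[OF that, of q y] qy(1,2) PM y(1) by (simp add: subset_iff)
    have "\<phi> d q = 0" if "d \<in> E" for d
      using sum0[of d] y(2)[OF that] that by simp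
    then have "q = 0"
      using inj[OF qy(2)] by blast
    have "\<phi> s y = 0" if "s \<in> S" for s
      using sum0[of s] zero[of s] \<open>q = 0\<close> that by simp
    then have "(\<Sum>s\<in>S. \<phi> s y *\<^sub>R b s) = 0" by simp
    with y(3) have "y = 0" by simp
    with \<open>q = 0\<close> qy(1) show ?thesis by simp
  qed
  ultimately show ?thesis by (rule ex_ex1I)
qed

section \<open>Bivariate polynomials of bounded total degree\<close>

lemma monomial2_apply: "monomial2 a b (x, y) = x ^ a * y ^ b"
  by (simp add: monomial2_def)

text \<open>The bound on the total degree is strict, so that \<open>P_below 0\<close> is the zero space. Each division by
  a linear factor lowers the bound by one and may thus end in \<open>P_below 0\<close> without a separate case.\<close>
definition P_below :: "nat \<Rightarrow> (real \<times> real \<Rightarrow> real) set" where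
  "P_below n = span {monomial2 a b | a b. a + b < n}"

lemma subspace_P_below: "subspace (P_below n)"
  by (simp add: P_below_def)

lemma P_space_eq: "P_space k = P_below (Suc k)"
  by (simp add: P_space_def P_below_def less_Suc_eq_le)

lemma P_below_mono: "m \<le> n \<Longrightarrow> P_below m \<subseteq> P_below n"
  unfolding P_below_def by (rule span_mono) force

lemma Q_space_subset: "Q_space k \<subseteq> P_below (2 * k + 1)"
  unfolding Q_space_def P_below_def by (rule span_mono) force

lemma P_below_0: "f \<in> P_below 0 \<Longrightarrow> f = 0"
  by (simp add: P_below_def)

lemma monomial2_in_P_below: "a + b < n \<Longrightarrow> monomial2 a b \<in> P_below n"
  unfolding P_below_def by (rule span_base) blast

lemma P_below_induct [consumes 1, case_names zero add_monomial]:
  assumes "f \<in> P_below n" and "Q 0"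
    and "\<And>c a b g. a + b < n \<Longrightarrow> Q g \<Longrightarrow> Q (c *\<^sub>R monomial2 a b + g)"
  shows "Q f"
  using assms(1) unfolding P_below_def
  by (induction rule: real_vector.span_induct_alt) (use assms(2,3) in blast)+

text \<open>On a line the total degree bounds the degree in one variable; the vanishing of high coefficients
  expresses this bound uniformly, including for the zero polynomial.\<close>
lemma P_below_restrict:
  assumes "f \<in> P_below n"
  shows "\<exists>r. (\<forall>i\<ge>n. coeff r i = 0) \<and> (\<forall>y. f (x, y) = poly r y)"
  using assms
proof (induction rule: P_below_induct)
  case zero
  show ?case by (rule exI[of _ 0]) auto
next
  case (add_monomial c a b g)
  then obtain r where "\<forall>i\<ge>n. coeff r i = 0" "\<forall>y. g (x, y) = poly r y" by blast
  with add_monomial(1) show ?case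
    by (intro exI[of _ "monom (c * x ^ a) b + r"])
      (auto simp: monomial2_def scaleR_fun_def poly_monom)
qed

text \<open>Exchanging the variables turns statements about vertical lines into statements about horizontal ones.\<close>
lemma P_below_swap:
  assumes "f \<in> P_below n"
  shows "(\<lambda>(x, y). f (y, x)) \<in> P_below n"
  using assms
proof (induction rule: P_below_induct)
  case zero
  show ?case
    using subspace_0[OF subspace_P_below[of n]] by (simp add: zero_fun_def)
next
  case (add_monomial c a b g)
  have "(\<lambda>(x, y). (c *\<^sub>R monomial2 a b + g) (y, x)) = c *\<^sub>R monomial2 b a + (\<lambda>(x, y). g (y, x))"
    by (auto simp: fun_eq_iff monomial2_def scaleR_fun_def)
  moreover have "monomial2 b a \<in> P_below n"
    using add_monomial(1) by (intro monomial2_in_P_below) simp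
  ultimately show ?case
    using subspace_add[OF subspace_P_below subspace_scale[OF subspace_P_below] add_monomial(2)] by metis
qed

lemma pdx_eqI: "((\<lambda>t. f (t, y)) has_real_derivative D) (at x) \<Longrightarrow> pdx f (x, y) = D"
  using DERIV_shift[of "\<lambda>t. f (t, y)" D 0 x]
  by (auto simp: pdx_def dir_deriv_def add.commute intro!: DERIV_imp_deriv)

lemma pdy_eqI: "((\<lambda>t. f (x, t)) has_real_derivative D) (at y) \<Longrightarrow> pdy f (x, y) = D"
  using DERIV_shift[of "\<lambda>t. f (x, t)" D 0 y]
  by (auto simp: pdy_def dir_deriv_def add.commute intro!: DERIV_imp_deriv)

lemma pdy_swap: "pdy (\<lambda>(x, y). f (y, x)) (x, y) = pdx f (y, x)"
  by (simp add: pdx_def pdy_def dir_deriv_def)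

lemma P_below_DERIV_y:
  assumes "f \<in> P_below n"
  shows "((\<lambda>t. f (x, t)) has_real_derivative pdy f (x, y)) (at y)"
proof -
  obtain r where "\<forall>y. f (x, y) = poly r y"
    using P_below_restrict[OF assms] by blast
  then have *: "(\<lambda>t. f (x, t)) = poly r" by auto
  have "((\<lambda>t. f (x, t)) has_real_derivative poly (pderiv r) y) (at y)"
    by (simp add: * poly_DERIV)
  with pdy_eqI[OF this] show ?thesis by simp
qed

lemma P_below_DERIV_x:
  assumes "f \<in> P_below n"
  shows "((\<lambda>t. f (t, y)) has_real_derivative pdx f (x, y)) (at x)"
  using P_below_DERIV_y[OF P_below_swap[OF assms], of y x] by (simp add: pdy_swap)

lemma pdx_add:
  assumes "f \<in> P_below n" "g \<in> P_below m"
  shows "pdx (f + g) = pdx f + pdx g"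
proof
  fix z
  show "pdx (f + g) z = (pdx f + pdx g) z"
    by (cases z) (auto intro!: pdx_eqI derivative_eq_intros P_below_DERIV_x[OF assms(1)]
        P_below_DERIV_x[OF assms(2)])
qed

lemma pdx_scaleR:
  assumes "f \<in> P_below n"
  shows "pdx (c *\<^sub>R f) = c *\<^sub>R pdx f"
proof
  fix z
  show "pdx (c *\<^sub>R f) z = (c *\<^sub>R pdx f) z"
    by (cases z) (auto simp: scaleR_fun_def intro!: pdx_eqI derivative_eq_intros
        P_below_DERIV_x[OF assms])
qed

lemma pdy_add:
  assumes "f \<in> P_below n" "g \<in> P_below m"
  shows "pdy (f + g) = pdy f + pdy g"
proof
  fix z
  show "pdy (f + g) z = (pdy f + pdy g) z"
    by (cases z) (auto intro!: pdy_eqI derivative_eq_intros P_below_DERIV_y[OF assms(1)]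
        P_below_DERIV_y[OF assms(2)])
qed

lemma pdy_scaleR:
  assumes "f \<in> P_below n"
  shows "pdy (c *\<^sub>R f) = c *\<^sub>R pdy f"
proof
  fix z
  show "pdy (c *\<^sub>R f) z = (c *\<^sub>R pdy f) z"
    by (cases z) (auto simp: scaleR_fun_def intro!: pdy_eqI derivative_eq_intros
        P_below_DERIV_y[OF assms])
qed

lemma pdx_monomial2: "pdx (monomial2 a b) = real a *\<^sub>R monomial2 (a - 1) b"
proof
  fix z
  show "pdx (monomial2 a b) z = (real a *\<^sub>R monomial2 (a - 1) b) z"
    by (cases z) (auto simp: scaleR_fun_def monomial2_def intro!: pdx_eqI derivative_eq_intros)
qed

lemma pdx_P_below:
  assumes "f \<in> P_below n"
  shows "pdx f \<in> P_below n"
proof -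
  have "f \<in> P_below n \<and> pdx f \<in> P_below n"
    using assms
  proof (induction rule: P_below_induct)
    case zero
    have "pdx 0 = 0"
      using pdx_scaleR[OF subspace_0[OF subspace_P_below[of n]], of 0] by simp
    then show ?case
      using subspace_0[OF subspace_P_below[of n]] by metis
  next
    case (add_monomial c a b g)
    then have m: "monomial2 a b \<in> P_below n" "monomial2 (a - 1) b \<in> P_below n"
      by (auto intro!: monomial2_in_P_below)
    note closed = subspace_add[OF subspace_P_below] subspace_scale[OF subspace_P_below]
    have cm: "c *\<^sub>R monomial2 a b \<in> P_below n"
      by (intro closed m)
    have "pdx (c *\<^sub>R monomial2 a b + g) = c *\<^sub>R real a *\<^sub>R monomial2 (a - 1) b + pdx g"
      using add_monomial(2) by (subst pdx_add[OF cm, of _ n]) (simp_all only: pdx_scaleR[OF m(1)] pdx_monomial2)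
    moreover have "c *\<^sub>R monomial2 a b + g \<in> P_below n"
      "c *\<^sub>R real a *\<^sub>R monomial2 (a - 1) b + pdx g \<in> P_below n"
      using add_monomial(2) by (blast intro: closed m)+
    ultimately show ?case by metis
  qed
  then show ?thesis ..
qed

lemma inj_monomial2: "inj (\<lambda>(a, b). monomial2 a b)"
proof (rule injI, clarify)
  fix a b a' b' assume eq: "monomial2 a b = monomial2 a' b'"
  from fun_cong[OF eq, of "(2, 1)"] fun_cong[OF eq, of "(1, 2)"]
  show "a = a' \<and> b = b'" by (simp add: monomial2_def)
qed

lemma independent_monomials: "independent {monomial2 a b | a b. a + b \<le> k}"
proof -
  let ?T = "{(a, b). a + b \<le> k}"
  have T: "?T = (SIGMA a:{..k}. {..k - a})" by auto
  have B: "{monomial2 a b | a b. a + b \<le> k} = (\<lambda>(a, b). monomial2 a b) ` ?T" by auto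
  show ?thesis
    unfolding B
  proof (rule independent_if_scalars_zero)
    show "finite ((\<lambda>(a, b). monomial2 a b) ` ?T)" by (simp add: T)
  next
    fix c v assume sum0: "(\<Sum>v\<in>(\<lambda>(a, b). monomial2 a b) ` ?T. c v *\<^sub>R v) = 0"
      and v: "v \<in> (\<lambda>(a, b). monomial2 a b) ` ?T"
    have "(\<Sum>v\<in>(\<lambda>(a, b). monomial2 a b) ` ?T. c v *\<^sub>R v)
        = (\<Sum>(a, b)\<in>?T. c (monomial2 a b) *\<^sub>R monomial2 a b)"
      using inj_monomial2 by (subst sum.reindex) (auto intro: inj_on_subset simp: case_prod_unfold)
    also have "\<dots> = (\<Sum>a\<le>k. \<Sum>b\<le>k - a. c (monomial2 a b) *\<^sub>R monomial2 a b)"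
      unfolding T by (subst sum.Sigma) auto
    finally have zero: "(\<Sum>a\<le>k. \<Sum>b\<le>k - a. c (monomial2 a b) *\<^sub>R monomial2 a b) = 0"
      using sum0 by simp
    have "(\<Sum>a\<le>k. (\<Sum>b\<le>k - a. c (monomial2 a b) * y ^ b) * x ^ a) = 0" for x y
      using fun_cong[OF zero, of "(x, y)"]
      by (simp add: sum_apply_at scaleR_fun_def monomial2_apply sum_distrib_right sum_distrib_left mult_ac)
    then have "(\<Sum>b\<le>k - a. c (monomial2 a b) * y ^ b) = 0" if "a \<le> k" for a y
      using polyfun_eq_0[of "\<lambda>a. \<Sum>b\<le>k - a. c (monomial2 a b) * y ^ b" k] that by blast
    then have "c (monomial2 a b) = 0" if "a \<le> k" "b \<le> k - a" for a b
      using polyfun_eq_0[of "\<lambda>b. c (monomial2 a b)" "k - a"] that by blast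
    with v show "c v = 0" by auto
  qed
qed

lemma card_monomials: "card {monomial2 a b | a b. a + b \<le> k} = (\<Sum>a\<le>k. Suc (k - a))"
proof -
  have "{monomial2 a b | a b. a + b \<le> k} = (\<lambda>(a, b). monomial2 a b) ` (SIGMA a:{..k}. {..k - a})"
    by force
  then show ?thesis
    using inj_monomial2 by (simp add: card_image inj_on_subset)
qed

section \<open>Division by equations of lines\<close>

text \<open>Uniqueness for Hermite interpolation with nodes \<open>t j\<close>, where the nodes indexed by \<open>K\<close> count
  twice: a nonzero polynomial cannot have more roots with multiplicity than its degree.\<close>
lemma poly_eq_0_by_double_roots:
  fixes r :: "real poly" and t :: "'i \<Rightarrow> real"
  assumes finJ: "finite J" and inj: "inj_on t J" and KJ: "K \<subseteq> J"
    and deg: "\<forall>i\<ge>card J + card K. coeff r i = 0"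
    and J: "\<And>j. j \<in> J \<Longrightarrow> poly r (t j) = 0" and K: "\<And>j. j \<in> K \<Longrightarrow> poly (pderiv r) (t j) = 0"
  shows "r = 0"
proof (rule ccontr)
  assume r: "r \<noteq> 0"
  have "(if j \<in> K then 2 else 1) \<le> order (t j) r" if j: "j \<in> J" for j
  proof -
    have "order (t j) r \<noteq> 0"
      using J[OF j] r by (simp add: order_root)
    moreover have "order (t j) r \<noteq> 1" if "j \<in> K"
    proof
      assume ord: "order (t j) r = 1"
      have "pderiv r \<noteq> 0"
        using ord order_degree[OF r, of "t j"] by (auto simp: pderiv_eq_0_iff)
      moreover have "order (t j) (pderiv r) = 0"
        using order_pderiv[of r "t j"] ord r J[OF j] by (simp add: order_root)
      ultimately show False
        using K[OF that] by (simp add: order_root)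
    qed
    ultimately show ?thesis by auto
  qed
  then have "(\<Sum>j\<in>J. if j \<in> K then 2 else 1) \<le> (\<Sum>j\<in>J. order (t j) r)"
    by (rule sum_mono)
  moreover have "(\<Sum>j\<in>J. if j \<in> K then 2 else 1) = card J + card K"
  proof -
    have "(\<Sum>j\<in>J. if j \<in> K then 2 else 1) = (\<Sum>j\<in>J. 1 + (if j \<in> K then 1 else 0 :: nat))"
      by (rule sum.cong) auto
    also have "\<dots> = card J + card (J \<inter> K)"
      using finJ by (simp only: sum.distrib sum.inter_restrict[symmetric]) simp
    finally show ?thesis
      using KJ by (simp add: Int_absorb1)
  qed
  moreover have "(\<Sum>j\<in>J. order (t j) r) = (\<Sum>x\<in>t ` J. order x r)"
    by (simp add: sum.reindex[OF inj])
  moreover have "\<dots> \<le> (\<Sum>x | poly r x = 0. order x r)"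
    by (rule sum_mono2) (auto simp: poly_roots_finite[OF r] J)
  moreover have "\<dots> \<le> degree r"
    using r by (rule sum_order_le_degree)
  ultimately have "card J + card K \<le> degree r" by linarith
  with deg have "coeff r (degree r) = 0" by blast
  with r show False by simp
qed

definition times_x :: "real \<Rightarrow> (real \<times> real \<Rightarrow> real) \<Rightarrow> real \<times> real \<Rightarrow> real" where
  "times_x x0 f = (\<lambda>(x, y). (x - x0) * f (x, y))"

definition times_y :: "real \<Rightarrow> (real \<times> real \<Rightarrow> real) \<Rightarrow> real \<times> real \<Rightarrow> real" where
  "times_y y0 f = (\<lambda>(x, y). (y - y0) * f (x, y))"

text \<open>The quotient of the division by \<open>x - x0\<close> loses one in total degree: for a monomial this is the
  factorisation of \<open>x ^ a - x0 ^ a\<close>, and the claim is linear.\<close>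
lemma P_below_remainder_x:
  assumes "f \<in> P_below n"
  shows "\<exists>s\<in>P_below (n - 1). \<forall>x y. f (x, y) - f (x0, y) = (x - x0) * s (x, y)"
  using assms
proof (induction rule: P_below_induct)
  case zero
  show ?case
    by (rule bexI[of _ 0]) (auto simp: subspace_0 subspace_P_below)
next
  case (add_monomial c a b g)
  then obtain s where s: "s \<in> P_below (n - 1)" "\<forall>x y. g (x, y) - g (x0, y) = (x - x0) * s (x, y)"
    by blast
  define m where "m = (\<Sum>i<a. x0 ^ (a - 1 - i) *\<^sub>R monomial2 i b)"
  have m: "m \<in> P_below (n - 1)"
    unfolding m_def using add_monomial(1)
    by (intro subspace_sum[OF subspace_P_below] subspace_scale[OF subspace_P_below]
        monomial2_in_P_below) auto
  have "x ^ a * y ^ b - x0 ^ a * y ^ b = (x - x0) * m (x, y)" for x y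
  proof -
    have "m (x, y) = (\<Sum>i<a. x0 ^ (a - Suc i) * x ^ i) * y ^ b"
      by (simp add: m_def sum_apply_at scaleR_fun_def monomial2_apply sum_distrib_right sum_distrib_left mult_ac)
    moreover have "x ^ a - x0 ^ a = (x - x0) * (\<Sum>i<a. x0 ^ (a - Suc i) * x ^ i)"
      by (rule power_diff_sumr2)
    ultimately show ?thesis
      by (simp add: left_diff_distrib[symmetric] mult_ac)
  qed
  then have m_eq: "x ^ a * y ^ b - x0 ^ a * y ^ b = (x - x0) * m (x, y)" for x y .
  have "(c *\<^sub>R monomial2 a b + g) (x, y) - (c *\<^sub>R monomial2 a b + g) (x0, y)
      = (x - x0) * (c *\<^sub>R m + s) (x, y)" for x y
  proof -
    have "(c *\<^sub>R monomial2 a b + g) (x, y) - (c *\<^sub>R monomial2 a b + g) (x0, y)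
        = c * (x ^ a * y ^ b - x0 ^ a * y ^ b) + (g (x, y) - g (x0, y))"
      by (simp add: scaleR_fun_def monomial2_apply right_diff_distrib)
    also have "\<dots> = c * ((x - x0) * m (x, y)) + (x - x0) * s (x, y)"
      unfolding m_eq using s(2) by simp
    also have "\<dots> = (x - x0) * (c *\<^sub>R m + s) (x, y)"
      by (simp add: scaleR_fun_def distrib_left mult.left_commute)
    finally show ?thesis .
  qed
  moreover have "c *\<^sub>R m + s \<in> P_below (n - 1)"
    using m s(1) by (intro subspace_add[OF subspace_P_below] subspace_scale[OF subspace_P_below])
  ultimately show ?case by blast
qed

text \<open>Peeling off a line. As many interpolation conditions as the restriction to the line has
  coefficients make that restriction zero, so the polynomial is divisible by the equation of the line.\<close>
lemma divide_by_vertical_line: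
  assumes f: "f \<in> P_below n" and J: "finite J" "inj_on t J" "K \<subseteq> J" "n \<le> card J + card K"
    and zero: "\<And>j. j \<in> J \<Longrightarrow> f (x0, t j) = 0" and dzero: "\<And>j. j \<in> K \<Longrightarrow> pdy f (x0, t j) = 0"
  shows "\<exists>s\<in>P_below (n - 1). f = times_x x0 s"
proof -
  obtain r where r: "\<forall>i\<ge>n. coeff r i = 0" "\<forall>y. f (x0, y) = poly r y"
    using P_below_restrict[OF f] by blast
  have "(\<lambda>y. f (x0, y)) = poly r" using r(2) by auto
  then have "pdy f (x0, y) = poly (pderiv r) y" for y
    by (intro pdy_eqI) (simp add: poly_DERIV)
  with zero dzero r J have "r = 0"
    by (intro poly_eq_0_by_double_roots[of J t K r]) auto
  moreover obtain s where s: "s \<in> P_below (n - 1)"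
    "\<forall>x y. f (x, y) - f (x0, y) = (x - x0) * s (x, y)"
    using P_below_remainder_x[OF f] by blast
  ultimately have "f = times_x x0 s"
    using r(2) by (auto simp: times_x_def fun_eq_iff)
  with s(1) show ?thesis by blast
qed

lemma divide_by_horizontal_line:
  assumes f: "f \<in> P_below n" and J: "finite J" "inj_on t J" "K \<subseteq> J" "n \<le> card J + card K"
    and zero: "\<And>j. j \<in> J \<Longrightarrow> f (t j, y0) = 0" and dzero: "\<And>j. j \<in> K \<Longrightarrow> pdx f (t j, y0) = 0"
  shows "\<exists>s\<in>P_below (n - 1). f = times_y y0 s"
proof -
  obtain s where s: "s \<in> P_below (n - 1)" "(\<lambda>(x, y). f (y, x)) = times_x y0 s"
    using divide_by_vertical_line[OF P_below_swap[OF f] J, of y0] zero dzero by (auto simp: pdy_swap)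
  have "f (x, y) = (y - y0) * s (y, x)" for x y
    using fun_cong[OF s(2), of "(y, x)"] by (simp add: times_x_def)
  then have "f = times_y y0 (\<lambda>(x, y). s (y, x))"
    by (auto simp: times_y_def)
  with P_below_swap[OF s(1)] show ?thesis by blast
qed

text \<open>The horizontal line through \<open>u 1\<close> carries \<open>n\<close> of the points and can be divided out; the points
  that remain form the same kind of triangle with one row less.\<close>
lemma triangular_lattice_unisolvent:
  assumes "f \<in> P_below n" and "inj_on t {1..n}" and "inj_on u {1..n}"
    and "\<And>i j. j \<in> {1..i} \<Longrightarrow> i \<in> {1..n} \<Longrightarrow> f (t i, u j) = 0"
  shows "f = 0"
  using assms
proof (induction n arbitrary: f t u)
  case 0
  then show ?case by (blast dest: P_below_0)
next
  case (Suc n)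
  obtain s where s: "s \<in> P_below n" "f = times_y (u 1) s"
    using divide_by_horizontal_line[of f "Suc n" "{1..Suc n}" t "{}" "u 1"] Suc.prems by auto
  have "s = 0"
  proof (rule Suc.IH[OF s(1), of "t \<circ> Suc" "u \<circ> Suc"])
    show "inj_on (t \<circ> Suc) {1..n}" "inj_on (u \<circ> Suc) {1..n}"
      by (intro comp_inj_on inj_on_subset[OF Suc.prems(2)] inj_on_subset[OF Suc.prems(3)]; force)+
    fix i j assume ij: "j \<in> {1..i}" "i \<in> {1..n}"
    then have "f (t (Suc i), u (Suc j)) = 0"
      by (intro Suc.prems(4)) auto
    moreover have "u (Suc j) \<noteq> u 1"
      using inj_onD[OF Suc.prems(3), of "Suc j" 1] ij by auto
    ultimately show "s ((t \<circ> Suc) i, (u \<circ> Suc) j) = 0"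
      by (simp add: s(2) times_y_def)
  qed
  then show ?case
    by (auto simp: s(2) times_y_def)
qed

lemma times_x_apply [simp]: "times_x x0 f (x, y) = (x - x0) * f (x, y)"
  by (simp add: times_x_def)

lemma times_y_apply [simp]: "times_y y0 f (x, y) = (y - y0) * f (x, y)"
  by (simp add: times_y_def)

lemma times_x_P_below:
  assumes "f \<in> P_below n"
  shows "times_x x0 f \<in> P_below (Suc n)"
  using assms
proof (induction rule: P_below_induct)
  case zero
  have "times_x x0 0 = 0" by (auto simp: times_x_def)
  then show ?case
    using subspace_0[OF subspace_P_below] by metis
next
  case (add_monomial c a b g)
  have eq: "times_x x0 (c *\<^sub>R monomial2 a b + g)
      = c *\<^sub>R monomial2 (Suc a) b + (- (x0 * c)) *\<^sub>R monomial2 a b + times_x x0 g"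
    by (rule ext) (auto simp: times_x_def scaleR_fun_def monomial2_def algebra_simps)
  show ?case
    unfolding eq using add_monomial
    by (intro subspace_add[OF subspace_P_below] subspace_scale[OF subspace_P_below]
        monomial2_in_P_below) simp_all
qed

lemma pdx_times_x:
  assumes "f \<in> P_below n"
  shows "pdx (times_x x0 f) (x, y) = f (x, y) + (x - x0) * pdx f (x, y)"
  by (auto intro!: pdx_eqI derivative_eq_intros P_below_DERIV_x[OF assms])

lemma pdy_times_y:
  assumes "f \<in> P_below n"
  shows "pdy (times_y y0 f) (x, y) = f (x, y) + (y - y0) * pdy f (x, y)"
  by (auto intro!: pdy_eqI derivative_eq_intros P_below_DERIV_y[OF assms])

lemma times_y_P_below:
  assumes "f \<in> P_below n"
  shows "times_y y0 f \<in> P_below (Suc n)"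
proof -
  have "times_y y0 f = (\<lambda>(x, y). times_x y0 (\<lambda>(x, y). f (y, x)) (y, x))"
    by (auto simp: times_y_def)
  then show ?thesis
    using P_below_swap[OF times_x_P_below[OF P_below_swap[OF assms]]] by metis
qed

lemma pdx_times_y:
  assumes "f \<in> P_below n"
  shows "pdx (times_y y0 f) (x, y) = (y - y0) * pdx f (x, y)"
  by (auto intro!: pdx_eqI derivative_eq_intros P_below_DERIV_x[OF assms])

text \<open>On the line that is divided out, the normal derivative of the product is the quotient itself.
  Conditions on the normal derivative of a polynomial that vanishes on an edge, and on its tangential
  derivative, are therefore conditions on the quotient.\<close>
lemma pdxy_times_x_on_line:
  assumes "f \<in> P_below n"
  shows "pdxy (times_x x0 f) (x0, y) = pdy f (x0, y)"
  unfolding pdxy_def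
  by (rule pdy_eqI) (simp add: pdx_times_x[OF assms] P_below_DERIV_y[OF assms])

lemma pdxy_times_y_on_line:
  assumes "f \<in> P_below n"
  shows "pdxy (times_y y0 f) (x, y0) = pdx f (x, y0)"
  unfolding pdxy_def
  by (rule pdy_eqI) (auto simp: pdx_times_y[OF assms]
      intro!: derivative_eq_intros P_below_DERIV_y[OF pdx_P_below[OF assms]])

section \<open>Polynomials determined by boundary and interior data\<close>

lemma bell_dof_add:
  assumes "f \<in> P_below n" "g \<in> P_below n"
  shows "bell_dof k z h l i j (f + g) = bell_dof k z h l i j f + bell_dof k z h l i j g"
  by (simp add: bell_dof_def pdxy_def pdx_add[OF assms] pdy_add[OF assms]
      pdy_add[OF pdx_P_below[OF assms(1)] pdx_P_below[OF assms(2)]])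

lemma bell_dof_scaleR:
  assumes "f \<in> P_below n"
  shows "bell_dof k z h l i j (c *\<^sub>R f) = c * bell_dof k z h l i j f"
  by (simp add: bell_dof_def pdxy_def pdx_scaleR[OF assms] pdy_scaleR[OF assms]
      pdy_scaleR[OF pdx_P_below[OF assms]]) (simp add: scaleR_fun_def)

text \<open>The degrees of freedom that determine the component in \<open>P_k\<close>. The lines of the definition belong
  to the left edge (with double nodes at both vertices), the top edge (double node at the upper right
  vertex), the right edge, the bottom edge, and the interior triangle. Each line
  lists values, then normal derivatives, then the tangential derivatives of both at the double nodes.
  Sorted into conditions on the values and on the normal derivatives of each edge, the blocks have
  \<open>k + 1, k, k - 1, ..., k - 6\<close> elements, as many as the successive quotients have coefficients on the
  line that is divided out next.\<close>
definition polynomial_index :: "nat \<Rightarrow> (nat \<times> nat \<times> nat) set" where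
  "polynomial_index k =
    {1} \<times> {0} \<times> {0..k - 2} \<union> {2} \<times> {0} \<times> {0..k - 3} \<union> {3, 4} \<times> {0} \<times> {0, 1} \<union>
    {1} \<times> {1..k - 2} \<times> {k - 2} \<union> {3} \<times> {1..k - 3} \<times> {1} \<union> {(2, 1, k - 3), (4, 1, 1)} \<union>
    {1} \<times> {k - 2} \<times> {1..k - 3} \<union> {2} \<times> {1} \<times> {1..k - 4} \<union>
    {1} \<times> {3..k - 3} \<times> {0} \<union> {3} \<times> {3..k - 4} \<times> {0} \<union>
    {1} \<times> (SIGMA i:{1..k - 7}. {1..i})"

text \<open>The degrees of freedom of the eight Bell basis functions that enlarge \<open>P_k\<close>. All of them sit on
  the bottom edge.\<close>
definition bell_shape_index :: "nat \<Rightarrow> (nat \<times> nat \<times> nat) set" where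
  "bell_shape_index k =
    {(1, 1, 0), (1, 2, 0), (3, 1, 0), (3, 2, 0), (1, k - 2, 0), (2, 1, 0), (3, k - 3, 0), (4, 1, 0)}"

lemma finite_polynomial_index: "finite (polynomial_index k)"
  by (simp add: polynomial_index_def)

text \<open>The sum is the dimension of \<open>P_k\<close>. Writing it as \<open>1 + ... + (k + 1)\<close>, the eight edge blocks
  account for the summands from \<open>k - 6\<close> on and the interior triangle for those up to \<open>k - 7\<close>.\<close>
lemma card_polynomial_index:
  assumes "k \<ge> 6"
  shows "card (polynomial_index k) \<le> (\<Sum>a\<le>k. Suc (k - a))"
proof -
  obtain m where k: "k = m + 6"
    using assms by (metis add.commute le_Suc_ex)
  have un: "card A \<le> n \<Longrightarrow> card B \<le> l \<Longrightarrow> card (A \<union> B) \<le> n + l" for A B :: "'c set" and n l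
    using card_Un_le[of A B] by linarith
  have "card (polynomial_index k)
      \<le> (k - 1) + (k - 2) + 4 + (k - 2) + (k - 3) + 2 + (k - 3) + (k - 4) + (k - 5) + (k - 6)
        + (\<Sum>i\<in>{1..k - 7}. i)"
    unfolding polynomial_index_def using assms
    by (intro un) (simp_all add: card_cartesian_product card_insert_if)
  also have "\<dots> = 8 * m + 28 + (\<Sum>i\<in>{1..m - 1}. i)"
    by (simp add: k)
  also have "\<dots> = (\<Sum>i\<in>{1..m}. i) + 7 * m + 28"
    by (cases m) simp_all
  also have "\<dots> = (\<Sum>i\<in>{1..m + 7}. i)"
    by (simp add: eval_nat_numeral)
  also have "\<dots> = (\<Sum>a\<le>k. Suc a)"
    by (rule sum.reindex_bij_witness[of _ Suc "\<lambda>i. i - 1"]) (auto simp: k)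
  also have "\<dots> = (\<Sum>a\<le>k. Suc (k - a))"
    by (rule sum.reindex_bij_witness[of _ "\<lambda>a. k - a" "\<lambda>a. k - a"]) auto
  finally show ?thesis .
qed

lemma index_disjoint:
  assumes "k \<ge> 6"
  shows "polynomial_index k \<inter> bell_shape_index k = {}"
  using assms by (auto simp: polynomial_index_def bell_shape_index_def)

lemma index_subset:
  assumes "k \<ge> 6"
  shows "polynomial_index k \<union> bell_shape_index k \<subseteq> bell_index k"
  using assms by (auto simp: polynomial_index_def bell_shape_index_def bell_index_def)

text \<open>The polynomial is divided successively by the square of the equation of the left, top, right and
  bottom edge. Each division lowers the degree by one, so the later edges get by with fewer nodes. The
  nodes used on an edge lie away from the edges treated before, where the divisors do not vanish and
  the quotient inherits the conditions on \<open>q\<close>. What remains has degree at most \<open>k - 8\<close> and vanishes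
  on the interior triangle.\<close>
lemma P_space_determined:
  assumes k: "k \<ge> 6" and h: "h > 0" and q: "q \<in> P_space k"
    and dofs: "\<forall>(l, i, j) \<in> polynomial_index k. bell_dof k z h l i j q = 0"
  shows "q = 0"
proof -
  obtain X Y where z: "z = (X, Y)" by (cases z)
  define u where "u i = X + h * real i / (real k - 2)" for i
  define v where "v i = Y + h * real i / (real k - 2)" for i
  define u' where "u' i = X + h * real i / (real k - 3)" for i
  define v' where "v' i = Y + h * real i / (real k - 3)" for i
  have ends: "u 0 = X" "v 0 = Y" "u' 0 = X" "v' 0 = Y"
      "u (k - 2) = X + h" "v (k - 2) = Y + h" "u' (k - 3) = X + h" "v' (k - 3) = Y + h"
    using k by (simp_all add: u_def v_def u'_def v'_def of_nat_diff)
  have inj: "inj u" "inj v" "inj u'" "inj v'"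
    using k h by (auto intro!: injI simp: u_def v_def u'_def v'_def)
  have inj': "inj_on u A" "inj_on v A" "inj_on u' A" "inj_on v' A" for A
    using inj by (auto intro: inj_on_subset)
  have ne: "u i = u j \<longleftrightarrow> i = j" "v i = v j \<longleftrightarrow> i = j" "u' i = u' j \<longleftrightarrow> i = j" "v' i = v' j \<longleftrightarrow> i = j" for i j
    using inj by (auto dest: injD)
  have ne': "u i = X \<longleftrightarrow> i = 0" "v i = Y \<longleftrightarrow> i = 0" "u' i = X \<longleftrightarrow> i = 0" "v' i = Y \<longleftrightarrow> i = 0"
     "u i = X + h \<longleftrightarrow> i = k - 2" "v i = Y + h \<longleftrightarrow> i = k - 2"
     "u' i = X + h \<longleftrightarrow> i = k - 3" "v' i = Y + h \<longleftrightarrow> i = k - 3" for i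
    using ne[of i 0] ne(1,2)[of i "k - 2"] ne(3,4)[of i "k - 3"] by (simp_all only: ends)
  have val: "q (u i, v j) = 0" if "(1, i, j) \<in> polynomial_index k" for i j
    using dofs that by (auto simp: bell_dof_def z u_def v_def)
  have dx: "pdx q (X + h * real i, v' j) = 0" if "(2, i, j) \<in> polynomial_index k" for i j
    using dofs that by (auto simp: bell_dof_def z v'_def)
  have dy: "pdy q (u' i, Y + h * real j) = 0" if "(3, i, j) \<in> polynomial_index k" for i j
    using dofs that by (auto simp: bell_dof_def z u'_def)
  have dxy: "pdxy q (X + h * real i, Y + h * real j) = 0" if "(4, i, j) \<in> polynomial_index k" for i j
    using dofs that by (auto simp: bell_dof_def z)
  note idx = polynomial_index_def

  have q0: "q \<in> P_below (Suc k)"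
    using q by (simp add: P_space_eq)
  \<comment> \<open>Left edge: \<open>k + 1\<close> conditions, with double nodes at both vertices.\<close>
  have "\<exists>s\<in>P_below (Suc k - 1). q = times_x X s"
  proof (rule divide_by_vertical_line[OF q0, of "{0..k - 2}" v "{0, k - 2}"])
    show "q (X, v j) = 0" if "j \<in> {0..k - 2}" for j
      using val[of 0 j] that by (simp add: idx ends)
    show "pdy q (X, v j) = 0" if "j \<in> {0, k - 2}" for j
      using dy[of 0 0] dy[of 0 1] that by (auto simp: idx ends)
  qed (use k inj' in auto)
  then obtain s1 where s1: "s1 \<in> P_below k" "q = times_x X s1" by auto

  \<comment> \<open>Normal derivative on the left edge, which equals \<open>s1\<close> there.\<close>
  have "\<exists>s\<in>P_below (k - 1). s1 = times_x X s"
  proof (rule divide_by_vertical_line[OF s1(1), of "{0..k - 3}" v' "{0, k - 3}"])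
    show "s1 (X, v' j) = 0" if "j \<in> {0..k - 3}" for j
      using dx[of 0 j] that by (simp add: idx s1(2) pdx_times_x[OF s1(1)])
    show "pdy s1 (X, v' j) = 0" if "j \<in> {0, k - 3}" for j
      using dxy[of 0 0] dxy[of 0 1] that
      by (auto simp: idx ends s1(2) pdxy_times_x_on_line[OF s1(1)])
  qed (use k inj' in auto)
  then obtain s2 where s2: "s2 \<in> P_below (k - 1)" "s1 = times_x X s2" by auto

  \<comment> \<open>Top edge: the factors \<open>x - X\<close> do not vanish at the nodes other than the upper left vertex, so
    the conditions pass to \<open>s2\<close>.\<close>
  have s2_top: "s2 (u i, Y + h) = 0" if "i \<in> {1..k - 2}" for i
    using val[of i "k - 2"] that by (auto simp: idx ends ne' s1(2) s2(2))
  have s2_corner: "s2 (X + h, Y + h) = 0"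
    using s2_top[of "k - 2"] k by (simp add: ends)
  have "\<exists>s\<in>P_below (k - 1 - 1). s2 = times_y (Y + h) s"
  proof (rule divide_by_horizontal_line[OF s2(1), of "{1..k - 2}" u "{k - 2}"])
    show "pdx s2 (u j, Y + h) = 0" if "j \<in> {k - 2}" for j
      using dx[of 1 "k - 3"] s2_corner that h
      by (auto simp: idx ends s1(2) s2(2) pdx_times_x[OF s2(1)]
          pdx_times_x[OF times_x_P_below[OF s2(1)]])
  qed (use k inj' s2_top in auto)
  then obtain s3 where s3: "s3 \<in> P_below (k - 2)" "s2 = times_y (Y + h) s3"
    by (auto simp: numeral_2_eq_2)

  \<comment> \<open>The factor of the top edge is moved to the outside, so that the normal derivative there can
    be read off.\<close>
  have q3: "q = times_y (Y + h) (times_x X (times_x X s3))"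
    by (auto simp: fun_eq_iff s1(2) s2(2) s3(2))
  have x2s3: "times_x X (times_x X s3) \<in> P_below (Suc (Suc (k - 2)))"
    by (intro times_x_P_below s3(1))
  have s3_top: "s3 (u' i, Y + h) = 0" if "i \<in> {1..k - 3}" for i
    using dy[of i 1] that by (auto simp: idx ends ne' q3 pdy_times_y[OF x2s3])
  have s3_corner: "s3 (X + h, Y + h) = 0"
    using s3_top[of "k - 3"] k by (simp add: ends)
  have "\<exists>s\<in>P_below (k - 2 - 1). s3 = times_y (Y + h) s"
  proof (rule divide_by_horizontal_line[OF s3(1), of "{1..k - 3}" u' "{k - 3}"])
    show "pdx s3 (u' j, Y + h) = 0" if "j \<in> {k - 3}" for j
      using dxy[of 1 1] s3_corner that h
      by (auto simp: idx ends q3 pdxy_times_y_on_line[OF x2s3] pdx_times_x[OF s3(1)]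
          pdx_times_x[OF times_x_P_below[OF s3(1)]])
  qed (use k inj' s3_top in auto)
  then obtain s4 where s4: "s4 \<in> P_below (k - 3)" "s3 = times_y (Y + h) s4"
    by (auto simp: numeral_3_eq_3 numeral_2_eq_2)

  have q4: "q = times_x X (times_x X (times_y (Y + h) (times_y (Y + h) s4)))"
    by (simp only: s1(2) s2(2) s3(2) s4(2))
  \<comment> \<open>Right edge: the lower right vertex is not among the conditions, and the degree of \<open>s4\<close> is
    already so low that the \<open>k - 3\<close> nodes inside the edge suffice.\<close>
  have "\<exists>s\<in>P_below (k - 3 - 1). s4 = times_x (X + h) s"
  proof (rule divide_by_vertical_line[OF s4(1), of "{1..k - 3}" v "{}"])
    show "s4 (X + h, v j) = 0" if "j \<in> {1..k - 3}" for j
      using val[of "k - 2" j] that k h by (auto simp: idx ends ne' q4)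
  qed (use k inj' in auto)
  then obtain s5 where s5: "s5 \<in> P_below (k - 4)" "s4 = times_x (X + h) s5"
    by (auto simp: eval_nat_numeral)

  have q5: "q = times_x (X + h) (times_x X (times_x X (times_y (Y + h) (times_y (Y + h) s5))))"
    by (auto simp: fun_eq_iff q4 s5(2))
  have w5: "times_x X (times_x X (times_y (Y + h) (times_y (Y + h) s5))) \<in> P_below (Suc (Suc (Suc (Suc (k - 4)))))"
    by (intro times_x_P_below times_y_P_below s5(1))
  have "\<exists>s\<in>P_below (k - 4 - 1). s5 = times_x (X + h) s"
  proof (rule divide_by_vertical_line[OF s5(1), of "{1..k - 4}" v' "{}"])
    show "s5 (X + h, v' j) = 0" if "j \<in> {1..k - 4}" for j
      using dx[of 1 j] that k h by (auto simp: idx ends ne' q5 pdx_times_x[OF w5])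
  qed (use k inj' in auto)
  then obtain s6 where s6: "s6 \<in> P_below (k - 5)" "s5 = times_x (X + h) s6"
    by (auto simp: eval_nat_numeral)

  \<comment> \<open>Bottom edge: after six divisions \<open>k - 5\<close> zeros suffice, so that two of the \<open>k - 3\<close> nodes inside the
    edge can be left to the Bell functions.\<close>
  have "\<exists>s\<in>P_below (k - 5 - 1). s6 = times_y Y s"
  proof (rule divide_by_horizontal_line[OF s6(1), of "{3..k - 3}" u "{}"])
    show "s6 (u j, Y) = 0" if "j \<in> {3..k - 3}" for j
      using val[of j 0] that k h by (auto simp: idx ends ne' q5 s6(2))
  qed (use k inj' in auto)
  then obtain s7 where s7: "s7 \<in> P_below (k - 6)" "s6 = times_y Y s7"
    by (auto simp: eval_nat_numeral)

  define w7 where "w7 = times_x (X + h) (times_x (X + h) (times_x X (times_x X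
    (times_y (Y + h) (times_y (Y + h) s7)))))"
  have q7: "q = times_y Y w7"
    by (auto simp: fun_eq_iff w7_def q5 s6(2) s7(2))
  have w7: "w7 \<in> P_below (Suc (Suc (Suc (Suc (Suc (Suc (k - 6)))))))"
    unfolding w7_def by (intro times_x_P_below times_y_P_below s7(1))
  have "\<exists>s\<in>P_below (k - 6 - 1). s7 = times_y Y s"
  proof (rule divide_by_horizontal_line[OF s7(1), of "{3..k - 4}" u' "{}"])
    show "s7 (u' j, Y) = 0" if "j \<in> {3..k - 4}" for j
      using dy[of j 0] that k h by (auto simp: idx ends ne' q7 pdy_times_y[OF w7]) (auto simp: w7_def ne')
  qed (use k inj' in auto)
  then obtain s8 where s8: "s8 \<in> P_below (k - 7)" "s7 = times_y Y s8"
    by (auto simp: eval_nat_numeral)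

  have "s8 = 0"
  proof (rule triangular_lattice_unisolvent[OF s8(1), of u v])
    show "s8 (u i, v j) = 0" if "j \<in> {1..i}" "i \<in> {1..k - 7}" for i j
      using val[of i j] that k h by (auto simp: idx ne' q7 w7_def s8(2))
  qed (use inj' in auto)
  then show ?thesis
    by (auto simp: q7 w7_def s8(2) times_x_def times_y_def)
qed

lemma P_space_unisolvent:
  assumes k: "k \<ge> 6" and h: "h > 0"
  shows "\<exists>q\<in>P_space k. \<forall>d\<in>polynomial_index k. (\<lambda>(l, i, j). bell_dof k z h l i j) d q = w d"
proof -
  let ?B = "{monomial2 a b | a b. a + b \<le> k}" and ?\<phi> = "\<lambda>(l, i, j). bell_dof k z h l i j"
  have B: "span ?B = P_space k"
    by (simp add: P_space_def)
  show ?thesis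
    unfolding B[symmetric]
  proof (rule unisolvent_by_counting)
    show "independent ?B" by (rule independent_monomials)
    show "finite (polynomial_index k)" by (rule finite_polynomial_index)
    show "card (polynomial_index k) \<le> card ?B"
      using card_polynomial_index[OF k] by (simp only: card_monomials)
    show "?\<phi> d (f + g) = ?\<phi> d f + ?\<phi> d g" if "f \<in> span ?B" "g \<in> span ?B" for d f g
      using that bell_dof_add[of f "Suc k" g] unfolding B P_space_eq by (cases d) auto
    show "?\<phi> d (a *\<^sub>R f) = a * ?\<phi> d f" if "f \<in> span ?B" for d a f
      using that bell_dof_scaleR[of f "Suc k"] unfolding B P_space_eq by (cases d) auto
    show "f = 0" if "f \<in> span ?B" "\<forall>d\<in>polynomial_index k. ?\<phi> d f = 0" for f
      using that P_space_determined[OF k h, of f z] unfolding B by (auto simp: case_prod_unfold)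
  qed
qed

section \<open>The prescribed data as degrees of freedom of the Bell element\<close>

text \<open>The prescribed points of an edge are numbered from its second end point, the Bell degrees of freedom
  from its first; the numberings are related by the reflection of the indices.\<close>
lemma ball_reflect: "(\<forall>j\<in>{1..n}. Q j) \<longleftrightarrow> (\<forall>j\<in>{1..n}. Q (Suc n - j))" for n :: nat
proof
  assume *: "\<forall>j\<in>{1..n}. Q (Suc n - j)"
  show "\<forall>j\<in>{1..n}. Q j"
  proof
    fix j assume j: "j \<in> {1..n}"
    then have "Suc n - j \<in> {1..n}" by auto
    with * have "Q (Suc n - (Suc n - j))" by blast
    with j show "Q j" by simp
  qed
next
  assume *: "\<forall>j\<in>{1..n}. Q j"
  show "\<forall>j\<in>{1..n}. Q (Suc n - j)"
  proof
    fix j assume "j \<in> {1..n}"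
    then have "Suc n - j \<in> {1..n}" by auto
    with * show "Q (Suc n - j)" by blast
  qed
qed

lemma seg_point_reflect:
  assumes "j \<le> m" and "m > 0"
  shows "seg_point m (m - j) a b = a + (real j / real m) *\<^sub>R (b - a)"
proof -
  have "seg_point m (m - j) a b = ((real m - real j) / real m) *\<^sub>R a + (real j / real m) *\<^sub>R b"
    using assms(1) by (simp add: seg_point_def scaleR_add_right of_nat_diff divide_inverse mult.commute)
  also have "(real m - real j) / real m = 1 - real j / real m"
    using assms(2) by (simp add: field_simps)
  finally show ?thesis by (simp add: algebra_simps)
qed

definition boundary_index :: "nat \<Rightarrow> (nat \<times> nat \<times> nat) set" where
  "boundary_index k =
    {1} \<times> {0, k - 2} \<times> {0, k - 2} \<union> {2} \<times> {0, 1} \<times> {0, k - 3} \<union>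
    {3} \<times> {0, k - 3} \<times> {0, 1} \<union> {4} \<times> {0, 1} \<times> {0, 1} \<union>
    {1} \<times> {1..k - 3} \<times> {0, k - 2} \<union> {1} \<times> {0, k - 2} \<times> {1..k - 3} \<union>
    {2} \<times> {0, 1} \<times> {1..k - 4} \<union> {3} \<times> {1..k - 4} \<times> {0, 1}"

text \<open>The division into the part seen by \<open>P_k\<close> and the part seen by the Bell functions cuts across the
  edges; in total all boundary degrees of freedom of the Bell element occur.\<close>
lemma index_union:
  assumes "k \<ge> 6"
  shows "polynomial_index k \<union> bell_shape_index k
    = boundary_index k \<union> {1} \<times> (SIGMA i:{1..k - 7}. {1..i})"
proof -
  obtain m where k: "k = m + 6"
    using assms by (metis add.commute le_Suc_ex)
  have "(l, i, j) \<in> polynomial_index k \<union> bell_shape_index k \<longleftrightarrow>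
      (l, i, j) \<in> boundary_index k \<union> {1} \<times> (SIGMA i:{1..k - 7}. {1..i})" for l i j
  proof -
    consider "l = 1" | "l = 2" | "l = 3" | "l = 4" | "l \<notin> {1, 2, 3, 4}" by blast
    then show ?thesis
    proof cases
      case 1
      then show ?thesis
        by (simp add: polynomial_index_def bell_shape_index_def boundary_index_def k) presburger
    next
      case 2
      then show ?thesis
        by (simp add: polynomial_index_def bell_shape_index_def boundary_index_def k) presburger
    next
      case 3
      then show ?thesis
        by (simp add: polynomial_index_def bell_shape_index_def boundary_index_def k) presburger
    next
      case 4
      then show ?thesis
        by (auto simp: polynomial_index_def bell_shape_index_def boundary_index_def k)
    next
      case 5
      then show ?thesis
        by (simp add: polynomial_index_def bell_shape_index_def boundary_index_def)
    qed
  qed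
  then show ?thesis by (auto simp del: Un_iff)
qed

text \<open>A rewriting of the data that holds for arbitrary functions \<open>p\<close>: the functionals prescribed for
  \<open>V_k\<close> are the selected degrees of freedom of the Bell element, each once.\<close>
lemma prescription_by_bell_dofs:
  fixes k :: nat and h :: real
    and x1 x2 x3 x4 :: "real \<times> real"
    and vx1 vx2 vx3 vx4 :: "nat \<Rightarrow> real"
    and e12 e23 e43 e14 n43 n12 n23 n14 :: "nat \<Rightarrow> real"
    and c :: "nat \<Rightarrow> nat \<Rightarrow> real"
  assumes k: "k \<ge> 6"
    and x2: "x2 = x1 + h *\<^sub>R (1, 0)" and x3: "x3 = x1 + h *\<^sub>R (1, 1)" and x4: "x4 = x1 + h *\<^sub>R (0, 1)"
  obtains w where "\<And>p.
    (\<forall>(x, w) \<in> {(x1, vx1), (x2, vx2), (x3, vx3), (x4, vx4)}.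
       p x = w 0 \<and> pdx p x = w 1 \<and> pdy p x = w 2 \<and> pdxy p x = w 3) \<and>
    (\<forall>j \<in> {1..k - 3}.
       p (seg_point (k - 2) j x1 x2) = e12 j \<and>
       p (seg_point (k - 2) j x2 x3) = e23 j \<and>
       p (seg_point (k - 2) j x4 x3) = e43 j \<and>
       p (seg_point (k - 2) j x1 x4) = e14 j) \<and>
    (\<forall>j \<in> {1..k - 4}.
       pdy p (seg_point (k - 3) j x4 x3) = n43 j \<and>
       pdy p (seg_point (k - 3) j x1 x2) = n12 j \<and>
       pdx p (seg_point (k - 3) j x2 x3) = n23 j \<and>
       pdx p (seg_point (k - 3) j x1 x4) = n14 j) \<and>
    (k > 7 \<longrightarrow> (\<forall>i \<in> {1..k - 7}. \<forall>j \<in> {1..i}.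
       p ((real i *\<^sub>R x2 + real j *\<^sub>R x4 + (real k - 2 - real i - real j) *\<^sub>R x1) /\<^sub>R (real k - 2))
         = c i j)) \<longleftrightarrow>
    (\<forall>(l, i, j) \<in> polynomial_index k \<union> bell_shape_index k. bell_dof k x1 h l i j p = w (l, i, j))"
proof -
  obtain X Y where x1: "x1 = (X, Y)" by (cases x1)
  define w :: "nat \<times> nat \<times> nat \<Rightarrow> real" where "w = (\<lambda>(l, i, j).
    if l = 1 then
      if i = 0 then if j = 0 then vx1 0 else if j = k - 2 then vx4 0 else e14 (k - 2 - j)
      else if i = k - 2 then if j = 0 then vx2 0 else if j = k - 2 then vx3 0 else e23 (k - 2 - j)
      else if j = 0 then e12 (k - 2 - i) else if j = k - 2 then e43 (k - 2 - i) else c i j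
    else if l = 2 then
      if i = 0 then if j = 0 then vx1 1 else if j = k - 3 then vx4 1 else n14 (k - 3 - j)
      else if j = 0 then vx2 1 else if j = k - 3 then vx3 1 else n23 (k - 3 - j)
    else if l = 3 then
      if j = 0 then if i = 0 then vx1 2 else if i = k - 3 then vx2 2 else n12 (k - 3 - i)
      else if i = 0 then vx4 2 else if i = k - 3 then vx3 2 else n43 (k - 3 - i)
    else if i = 0 then if j = 0 then vx1 3 else vx4 3 else if j = 0 then vx2 3 else vx3 3)"
  have corners: "bell_dof k x1 h 1 0 0 p = p x1" "bell_dof k x1 h 1 (k - 2) 0 p = p x2"
    "bell_dof k x1 h 1 (k - 2) (k - 2) p = p x3" "bell_dof k x1 h 1 0 (k - 2) p = p x4"
    "bell_dof k x1 h 2 0 0 p = pdx p x1" "bell_dof k x1 h 2 1 0 p = pdx p x2"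
    "bell_dof k x1 h 2 1 (k - 3) p = pdx p x3" "bell_dof k x1 h 2 0 (k - 3) p = pdx p x4"
    "bell_dof k x1 h 3 0 0 p = pdy p x1" "bell_dof k x1 h 3 (k - 3) 0 p = pdy p x2"
    "bell_dof k x1 h 3 (k - 3) 1 p = pdy p x3" "bell_dof k x1 h 3 0 1 p = pdy p x4"
    "bell_dof k x1 h 4 0 0 p = pdxy p x1" "bell_dof k x1 h 4 1 0 p = pdxy p x2"
    "bell_dof k x1 h 4 1 1 p = pdxy p x3" "bell_dof k x1 h 4 0 1 p = pdxy p x4" for p
    using k by (simp_all add: bell_dof_def x1 x2 x3 x4 of_nat_diff)
  have reflect: "(\<forall>j\<in>{1..k - 3}. Q j) \<longleftrightarrow> (\<forall>j\<in>{1..k - 3}. Q (k - 2 - j))"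
    "(\<forall>j\<in>{1..k - 4}. Q j) \<longleftrightarrow> (\<forall>j\<in>{1..k - 4}. Q (k - 3 - j))" for Q
  proof -
    have "Suc (k - 3) = k - 2" "Suc (k - 4) = k - 3"
      using k by simp_all
    then show "(\<forall>j\<in>{1..k - 3}. Q j) \<longleftrightarrow> (\<forall>j\<in>{1..k - 3}. Q (k - 2 - j))"
      "(\<forall>j\<in>{1..k - 4}. Q j) \<longleftrightarrow> (\<forall>j\<in>{1..k - 4}. Q (k - 3 - j))"
      using ball_reflect[of "k - 3" Q] ball_reflect[of "k - 4" Q] by metis+
  qed
  have edge_values: "p (seg_point (k - 2) (k - 2 - j) x1 x2) = bell_dof k x1 h 1 j 0 p"
    "p (seg_point (k - 2) (k - 2 - j) x2 x3) = bell_dof k x1 h 1 (k - 2) j p"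
    "p (seg_point (k - 2) (k - 2 - j) x4 x3) = bell_dof k x1 h 1 j (k - 2) p"
    "p (seg_point (k - 2) (k - 2 - j) x1 x4) = bell_dof k x1 h 1 0 j p"
    if "j \<in> {1..k - 3}" for j p
  proof -
    have r: "real (k - 2) = real k - 2" "real k \<noteq> 2"
      using k by (auto simp: of_nat_diff)
    have *: "seg_point (k - 2) (k - 2 - j) a b = a + (real j / (real k - 2)) *\<^sub>R (b - a)" for a b
      unfolding r(1)[symmetric] using that k by (intro seg_point_reflect) auto
    show "p (seg_point (k - 2) (k - 2 - j) x1 x2) = bell_dof k x1 h 1 j 0 p"
    "p (seg_point (k - 2) (k - 2 - j) x2 x3) = bell_dof k x1 h 1 (k - 2) j p"
    "p (seg_point (k - 2) (k - 2 - j) x4 x3) = bell_dof k x1 h 1 j (k - 2) p"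
    "p (seg_point (k - 2) (k - 2 - j) x1 x4) = bell_dof k x1 h 1 0 j p"
      unfolding * using r by (simp_all add: bell_dof_def x1 x2 x3 x4 mult.commute)
  qed
  have derivs: "pdy p (seg_point (k - 3) (k - 3 - j) x4 x3) = bell_dof k x1 h 3 j 1 p"
    "pdy p (seg_point (k - 3) (k - 3 - j) x1 x2) = bell_dof k x1 h 3 j 0 p"
    "pdx p (seg_point (k - 3) (k - 3 - j) x2 x3) = bell_dof k x1 h 2 1 j p"
    "pdx p (seg_point (k - 3) (k - 3 - j) x1 x4) = bell_dof k x1 h 2 0 j p"
    if "j \<in> {1..k - 4}" for j p
  proof -
    have r: "real (k - 3) = real k - 3" "real k \<noteq> 3"
      using k by (auto simp: of_nat_diff)
    have *: "seg_point (k - 3) (k - 3 - j) a b = a + (real j / (real k - 3)) *\<^sub>R (b - a)" for a b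
      unfolding r(1)[symmetric] using that k by (intro seg_point_reflect) auto
    show "pdy p (seg_point (k - 3) (k - 3 - j) x4 x3) = bell_dof k x1 h 3 j 1 p"
    "pdy p (seg_point (k - 3) (k - 3 - j) x1 x2) = bell_dof k x1 h 3 j 0 p"
    "pdx p (seg_point (k - 3) (k - 3 - j) x2 x3) = bell_dof k x1 h 2 1 j p"
    "pdx p (seg_point (k - 3) (k - 3 - j) x1 x4) = bell_dof k x1 h 2 0 j p"
      unfolding * using r by (simp_all add: bell_dof_def x1 x2 x3 x4 mult.commute)
  qed
  have interior: "p ((real i *\<^sub>R x2 + real j *\<^sub>R x4 + (real k - 2 - real i - real j) *\<^sub>R x1) /\<^sub>R (real k - 2))
      = bell_dof k x1 h 1 i j p" for i j p
    using k by (auto intro!: arg_cong[of _ _ p] simp: bell_dof_def x1 x2 x4 field_simps)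
  have w_edges: "w (1, j, 0) = e12 (k - 2 - j)" "w (1, k - 2, j) = e23 (k - 2 - j)"
    "w (1, j, k - 2) = e43 (k - 2 - j)" "w (1, 0, j) = e14 (k - 2 - j)" if "j \<in> {1..k - 3}" for j
    using that k by (auto simp: w_def)
  have w_normal: "w (3, j, 1) = n43 (k - 3 - j)" "w (3, j, 0) = n12 (k - 3 - j)"
    "w (2, 1, j) = n23 (k - 3 - j)" "w (2, 0, j) = n14 (k - 3 - j)" if "j \<in> {1..k - 4}" for j
    using that k by (auto simp: w_def)
  have w_interior: "w (1, i, j) = c i j" if "i \<in> {1..k - 7}" "j \<in> {1..i}" for i j
    using that k by (auto simp: w_def)
  have w_corners: "w (1, 0, 0) = vx1 0" "w (1, k - 2, 0) = vx2 0" "w (1, k - 2, k - 2) = vx3 0" "w (1, 0, k - 2) = vx4 0"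
    "w (2, 0, 0) = vx1 1" "w (2, 1, 0) = vx2 1" "w (2, 1, k - 3) = vx3 1" "w (2, 0, k - 3) = vx4 1"
    "w (3, 0, 0) = vx1 2" "w (3, k - 3, 0) = vx2 2" "w (3, k - 3, 1) = vx3 2" "w (3, 0, 1) = vx4 2"
    "w (4, 0, 0) = vx1 3" "w (4, 1, 0) = vx2 3" "w (4, 1, 1) = vx3 3" "w (4, 0, 1) = vx4 3"
    using k by (simp_all add: w_def)
  have ball_prod: "(\<forall>(l, i, j)\<in>{a} \<times> A. Q l i j) \<longleftrightarrow> (\<forall>(i, j)\<in>A. Q a i j)" for a A and Q :: "nat \<Rightarrow> nat \<Rightarrow> nat \<Rightarrow> bool"
    by auto
  have ball_prod2: "(\<forall>(i, j)\<in>A \<times> B. Q i j) \<longleftrightarrow> (\<forall>i\<in>A. \<forall>j\<in>B. Q i j)" for A B and Q :: "nat \<Rightarrow> nat \<Rightarrow> bool"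
    by auto
  have ball_Sigma: "(\<forall>(i, j)\<in>Sigma A B. Q i j) \<longleftrightarrow> (\<forall>i\<in>A. \<forall>j\<in>B i. Q i j)" for A B and Q :: "nat \<Rightarrow> nat \<Rightarrow> bool"
    by auto
  have ball_two: "(\<forall>i\<in>{a, b}. Q i) \<longleftrightarrow> Q a \<and> Q b" for a b :: nat and Q
    by simp
  show thesis
  proof (rule that[of w])
    fix p
    have vertices: "(\<forall>(x, w) \<in> {(x1, vx1), (x2, vx2), (x3, vx3), (x4, vx4)}.
       p x = w 0 \<and> pdx p x = w 1 \<and> pdy p x = w 2 \<and> pdxy p x = w 3) \<longleftrightarrow>
      (\<forall>(l, i, j) \<in> {1} \<times> {0, k - 2} \<times> {0, k - 2} \<union> {2} \<times> {0, 1} \<times> {0, k - 3} \<union>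
        {3} \<times> {0, k - 3} \<times> {0, 1} \<union> {4} \<times> {0, 1} \<times> {0, 1}. bell_dof k x1 h l i j p = w (l, i, j))"
      unfolding ball_Un ball_prod ball_prod2 ball_two corners w_corners by auto
    have edges: "(\<forall>j \<in> {1..k - 3}.
       p (seg_point (k - 2) j x1 x2) = e12 j \<and>
       p (seg_point (k - 2) j x2 x3) = e23 j \<and>
       p (seg_point (k - 2) j x4 x3) = e43 j \<and>
       p (seg_point (k - 2) j x1 x4) = e14 j) \<longleftrightarrow>
      (\<forall>(l, i, j) \<in> {1} \<times> {1..k - 3} \<times> {0, k - 2} \<union> {1} \<times> {0, k - 2} \<times> {1..k - 3}.
        bell_dof k x1 h l i j p = w (l, i, j))"
      unfolding ball_Un ball_prod ball_prod2 ball_two reflect(1)[of "\<lambda>j. p (seg_point (k - 2) j x1 x2) = e12 j \<and> _ j"]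
      using edge_values[of _ p] w_edges by auto
    have normals: "(\<forall>j \<in> {1..k - 4}.
       pdy p (seg_point (k - 3) j x4 x3) = n43 j \<and>
       pdy p (seg_point (k - 3) j x1 x2) = n12 j \<and>
       pdx p (seg_point (k - 3) j x2 x3) = n23 j \<and>
       pdx p (seg_point (k - 3) j x1 x4) = n14 j) \<longleftrightarrow>
      (\<forall>(l, i, j) \<in> {2} \<times> {0, 1} \<times> {1..k - 4} \<union> {3} \<times> {1..k - 4} \<times> {0, 1}.
        bell_dof k x1 h l i j p = w (l, i, j))"
      unfolding ball_Un ball_prod ball_prod2 ball_two reflect(2)[of "\<lambda>j. pdy p (seg_point (k - 3) j x4 x3) = n43 j \<and> _ j"]
      using derivs[of _ p] w_normal by auto
    have inside: "(k > 7 \<longrightarrow> (\<forall>i \<in> {1..k - 7}. \<forall>j \<in> {1..i}.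
       p ((real i *\<^sub>R x2 + real j *\<^sub>R x4 + (real k - 2 - real i - real j) *\<^sub>R x1) /\<^sub>R (real k - 2))
         = c i j)) \<longleftrightarrow>
      (\<forall>(l, i, j) \<in> {1} \<times> (SIGMA i:{1..k - 7}. {1..i}). bell_dof k x1 h l i j p = w (l, i, j))"
      unfolding ball_prod ball_Sigma interior using w_interior by auto
    show "(\<forall>(x, w) \<in> {(x1, vx1), (x2, vx2), (x3, vx3), (x4, vx4)}.
         p x = w 0 \<and> pdx p x = w 1 \<and> pdy p x = w 2 \<and> pdxy p x = w 3) \<and>
      (\<forall>j \<in> {1..k - 3}.
         p (seg_point (k - 2) j x1 x2) = e12 j \<and>
         p (seg_point (k - 2) j x2 x3) = e23 j \<and>
         p (seg_point (k - 2) j x4 x3) = e43 j \<and>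
         p (seg_point (k - 2) j x1 x4) = e14 j) \<and>
      (\<forall>j \<in> {1..k - 4}.
         pdy p (seg_point (k - 3) j x4 x3) = n43 j \<and>
         pdy p (seg_point (k - 3) j x1 x2) = n12 j \<and>
         pdx p (seg_point (k - 3) j x2 x3) = n23 j \<and>
         pdx p (seg_point (k - 3) j x1 x4) = n14 j) \<and>
      (k > 7 \<longrightarrow> (\<forall>i \<in> {1..k - 7}. \<forall>j \<in> {1..i}.
         p ((real i *\<^sub>R x2 + real j *\<^sub>R x4 + (real k - 2 - real i - real j) *\<^sub>R x1) /\<^sub>R (real k - 2))
           = c i j)) \<longleftrightarrow>
      (\<forall>(l, i, j) \<in> polynomial_index k \<union> bell_shape_index k. bell_dof k x1 h l i j p = w (l, i, j))"
      unfolding index_union[OF k] boundary_index_def vertices edges normals inside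
      by (simp only: ball_Un conj_assoc)
  qed
qed

section \<open>Unisolvence of the enlarged space\<close>

theorem lemma4p1:
  fixes k :: nat and h :: real
    and x1 x2 x3 x4 :: "real \<times> real"
    and b :: "nat \<Rightarrow> nat \<Rightarrow> nat \<Rightarrow> real \<times> real \<Rightarrow> real"
    and vx1 vx2 vx3 vx4 :: "nat \<Rightarrow> real"
    and e12 e23 e43 e14 n43 n12 n23 n14 :: "nat \<Rightarrow> real"
    and c :: "nat \<Rightarrow> nat \<Rightarrow> real"
  assumes "k \<ge> 6" and "h > 0"
    and "x2 = x1 + h *\<^sub>R (1, 0)" and "x3 = x1 + h *\<^sub>R (1, 1)" and "x4 = x1 + h *\<^sub>R (0, 1)"
    and "bell_nodal_basis k x1 h b"
  shows "\<exists>!p. p \<in> V_space k b \<and>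
    (\<forall>(x, w) \<in> {(x1, vx1), (x2, vx2), (x3, vx3), (x4, vx4)}.
       p x = w 0 \<and> pdx p x = w 1 \<and> pdy p x = w 2 \<and> pdxy p x = w 3) \<and>
    (\<forall>j \<in> {1..k - 3}.
       p (seg_point (k - 2) j x1 x2) = e12 j \<and>
       p (seg_point (k - 2) j x2 x3) = e23 j \<and>
       p (seg_point (k - 2) j x4 x3) = e43 j \<and>
       p (seg_point (k - 2) j x1 x4) = e14 j) \<and>
    (\<forall>j \<in> {1..k - 4}.
       pdy p (seg_point (k - 3) j x4 x3) = n43 j \<and>
       pdy p (seg_point (k - 3) j x1 x2) = n12 j \<and>
       pdx p (seg_point (k - 3) j x2 x3) = n23 j \<and>
       pdx p (seg_point (k - 3) j x1 x4) = n14 j) \<and>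
    (k > 7 \<longrightarrow> (\<forall>i \<in> {1..k - 7}. \<forall>j \<in> {1..i}.
       p ((real i *\<^sub>R x2 + real j *\<^sub>R x4 + (real k - 2 - real i - real j) *\<^sub>R x1) /\<^sub>R (real k - 2))
         = c i j))"
proof -
  let ?E = "polynomial_index k" and ?S = "bell_shape_index k"
  let ?\<phi> = "\<lambda>(l, i, j). bell_dof k x1 h l i j" and ?b = "\<lambda>(l, i, j). b l i j"
  let ?M = "P_below (2 * k + 1)"
  obtain w where w: "\<And>p.
    (\<forall>(x, w) \<in> {(x1, vx1), (x2, vx2), (x3, vx3), (x4, vx4)}.
       p x = w 0 \<and> pdx p x = w 1 \<and> pdy p x = w 2 \<and> pdxy p x = w 3) \<and>
    (\<forall>j \<in> {1..k - 3}.
       p (seg_point (k - 2) j x1 x2) = e12 j \<and>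
       p (seg_point (k - 2) j x2 x3) = e23 j \<and>
       p (seg_point (k - 2) j x4 x3) = e43 j \<and>
       p (seg_point (k - 2) j x1 x4) = e14 j) \<and>
    (\<forall>j \<in> {1..k - 4}.
       pdy p (seg_point (k - 3) j x4 x3) = n43 j \<and>
       pdy p (seg_point (k - 3) j x1 x2) = n12 j \<and>
       pdx p (seg_point (k - 3) j x2 x3) = n23 j \<and>
       pdx p (seg_point (k - 3) j x1 x4) = n14 j) \<and>
    (k > 7 \<longrightarrow> (\<forall>i \<in> {1..k - 7}. \<forall>j \<in> {1..i}.
       p ((real i *\<^sub>R x2 + real j *\<^sub>R x4 + (real k - 2 - real i - real j) *\<^sub>R x1) /\<^sub>R (real k - 2))
         = c i j)) \<longleftrightarrow>
    (\<forall>(l, i, j) \<in> ?E \<union> ?S. bell_dof k x1 h l i j p = w (l, i, j))"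
    using prescription_by_bell_dofs[OF assms(1,3,4,5), of vx1 vx2 vx3 vx4 e12 e23 e43 e14 n43 n12 n23 n14 c]
    by blast
  have dual: "?\<phi> d (?b s) = (if d = s then 1 else 0)" and bell: "?b s \<in> bell_space k x1 h"
    if d: "d \<in> ?E \<union> ?S" and s: "s \<in> ?S" for d s
  proof -
    have "d \<in> bell_index k" "s \<in> bell_index k"
      using d s index_subset[OF assms(1)] by auto
    moreover obtain l i j where s_eq: "s = (l, i, j)" by (cases s)
    moreover obtain l' i' j' where d_eq: "d = (l', i', j')" by (cases d)
    ultimately have "b l i j \<in> bell_space k x1 h"
      "bell_dof k x1 h l' i' j' (b l i j) = (if (l', i', j') = (l, i, j) then 1 else 0)"
      using bspec[OF assms(6)[unfolded bell_nodal_basis_def], of s] by (simp, blast)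
    then show "?\<phi> d (?b s) = (if d = s then 1 else 0)" "?b s \<in> bell_space k x1 h"
      unfolding s_eq d_eq by simp_all
  qed
  have "\<exists>!p. p \<in> span (P_space k \<union> ?b ` ?S) \<and> (\<forall>d\<in>?E \<union> ?S. ?\<phi> d p = w d)"
  proof (rule unisolvent_extend_by_dual_vectors)
    show "subspace (P_space k)" "subspace ?M"
      by (simp_all add: P_space_eq subspace_P_below)
    show "P_space k \<subseteq> ?M"
      unfolding P_space_eq by (rule P_below_mono) simp
    show "?b ` ?S \<subseteq> ?M"
    proof
      fix f assume "f \<in> ?b ` ?S"
      then obtain s where "s \<in> ?S" "f = ?b s" by blast
      then have "f \<in> bell_space k x1 h"
        using bell[of s s] by simp
      then have "f \<in> Q_space k"
        by (simp add: bell_space_def)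
      then show "f \<in> ?M"
        using Q_space_subset by blast
    qed
    show "finite ?S" by (simp add: bell_shape_index_def)
    show "?E \<inter> ?S = {}" by (rule index_disjoint[OF assms(1)])
    show "?\<phi> d (f + g) = ?\<phi> d f + ?\<phi> d g" if "f \<in> ?M" "g \<in> ?M" for d f g
      using bell_dof_add[OF that] by (cases d) auto
    show "?\<phi> d (a *\<^sub>R f) = a * ?\<phi> d f" if "f \<in> ?M" for d a f
      using bell_dof_scaleR[OF that] by (cases d) auto
    show "\<exists>q\<in>P_space k. \<forall>d\<in>?E. ?\<phi> d q = v d" for v
      by (rule P_space_unisolvent[OF assms(1,2)])
    show "q = 0" if "q \<in> P_space k" "\<forall>d\<in>?E. ?\<phi> d q = 0" for q
      using that P_space_determined[OF assms(1,2), of q x1] by (auto simp: case_prod_unfold)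
  qed (rule dual)
  moreover have "span (P_space k \<union> ?b ` ?S) = V_space k b"
    by (simp add: V_space_def bell_shape_index_def)
  ultimately have "\<exists>!p. p \<in> V_space k b \<and> (\<forall>(l, i, j)\<in>?E \<union> ?S. bell_dof k x1 h l i j p = w (l, i, j))"
    by (simp only: case_prod_unfold prod.collapse)
  then show ?thesis
    unfolding w .
qed

end
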